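(* Let $n=p+q$ with $p\ge q$. For any real $n\times n$ invertible matrix $G$, there exist an $n\times n$ real orthogonal matrix $O$, two real invertible matrices $G_p\in \mathrm{GL}(p,\mathbb{R})$ and $G_q\in\mathrm{GL}(q,\mathbb{R})$, and $q$ unique (up to order and signs) real numbers $\theta_1,\dots,\theta_q$ such that $$G = O\begin{bmatrix} Ch & 0 & Sh\\ 0 & I_{p-q} & 0\\ Sh & 0 & Ch\end{bmatrix}\begin{bmatrix} G_p & 0\\ 0& G_q\end{bmatrix}.$$
   Context: $Ch=\operatorname{diag}(\cosh\theta_1,\dots,\cosh\theta_q)$ and $Sh=\operatorname{diag}(\sinh\theta_1,\dots,\sinh\theta_q)$ are $q\times q$ diagonal matrices. The block sizes of the middle factor are $q,\,p-q,\,q$. *)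

theory Defs
  imports Complex_Main "HOL-Combinatorics.Permutations" "Jordan_Normal_Form.Matrix"
begin

definition GL_real :: "nat \<Rightarrow> real mat set" where
  "GL_real n = {A \<in> carrier_mat n n. invertible_mat A}"

text \<open>The library's \<open>orthogonal_mat\<close> only asks for nonzero, pairwise orthogonal columns;
  here the columns are orthonormal.\<close>

definition orthogonal_group :: "nat \<Rightarrow> real mat set" where
  "orthogonal_group n = {Q \<in> carrier_mat n n. transpose_mat Q * Q = 1\<^sub>m n}"

text \<open>The matrix with block rows \<open>[Ch, 0, Sh]\<close>, \<open>[0, I, 0]\<close>, \<open>[Sh, 0, Ch]\<close> and block sizes
  \<open>q\<close>, \<open>p - q\<close>, \<open>q\<close> (for \<open>q \<le> p\<close>), assembled as a 2-by-2 block matrix with block sizes \<open>p\<close>, \<open>q\<close>.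
  Only the values of \<open>\<theta>\<close> on \<open>{..<q}\<close> matter. The zero matrices with no rows or no columns serve
  to stack, respectively juxtapose, two blocks.\<close>

definition hyperbolic_mat :: "nat \<Rightarrow> nat \<Rightarrow> (nat \<Rightarrow> real) \<Rightarrow> real mat" where
  "hyperbolic_mat p q \<theta> =
     (let Ch = mat_diag q (\<lambda>i. cosh (\<theta> i));
          Sh = mat_diag q (\<lambda>i. sinh (\<theta> i))
      in four_block_mat
           (four_block_mat Ch (0\<^sub>m q (p - q)) (0\<^sub>m (p - q) q) (1\<^sub>m (p - q)))
           (four_block_mat Sh (0\<^sub>m q 0) (0\<^sub>m (p - q) q) (0\<^sub>m (p - q) 0))
           (four_block_mat Sh (0\<^sub>m q (p - q)) (0\<^sub>m 0 q) (0\<^sub>m 0 (p - q)))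
           Ch)"

definition hyperbolic_decomposition ::
  "nat \<Rightarrow> nat \<Rightarrow> real mat \<Rightarrow> real mat \<Rightarrow> (nat \<Rightarrow> real) \<Rightarrow> real mat \<Rightarrow> real mat \<Rightarrow> bool" where
  "hyperbolic_decomposition p q G Q \<theta> Gp Gq \<longleftrightarrow>
     Q \<in> orthogonal_group (p + q) \<and> Gp \<in> GL_real p \<and> Gq \<in> GL_real q \<and>
     G = Q * hyperbolic_mat p q \<theta> * four_block_mat Gp (0\<^sub>m p q) (0\<^sub>m q p) Gq"

definition eq_up_to_order_and_signs :: "nat \<Rightarrow> (nat \<Rightarrow> real) \<Rightarrow> (nat \<Rightarrow> real) \<Rightarrow> bool" where
  "eq_up_to_order_and_signs q \<theta> \<theta>' \<longleftrightarrow>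
     (\<exists>\<pi>. \<pi> permutes {..<q} \<and> (\<forall>i<q. \<theta>' i = \<theta> (\<pi> i) \<or> \<theta>' i = - \<theta> (\<pi> i)))"

end

theory Submission
  imports Defs "Jordan_Normal_Form.Spectral_Radius"
begin

text \<open>Write \<open>H \<theta>\<close> for the hyperbolic matrix. It is symmetric and \<open>H \<theta> * H \<phi> = H (\<theta> + \<phi>)\<close>, so a
  decomposition \<open>G = Q * H \<theta> * N\<close> with \<open>N\<close> block diagonal is the same as a block diagonal congruence
  \<open>G\<^sup>T * G = N\<^sup>T * H (2 \<theta>) * N\<close>.

  For existence, orthonormalise the first \<open>p\<close> and the last \<open>q\<close> columns of \<open>G\<close> separately and apply the
  singular value decomposition to the matrix of inner products of the two orthonormal families. Up to
  block diagonal factors, \<open>G\<^sup>T * G\<close> then has identity diagonal blocks and the singular values \<open>s i\<close> in the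
  off-diagonal ones. Invertibility of \<open>G\<close> forces \<open>\<bar>s i\<bar> < 1\<close>, so \<open>s i = tanh (2 \<theta> i)\<close>, and rescaling
  by \<open>sqrt (cosh (2 \<theta> i))\<close> yields \<open>H (2 \<theta>)\<close>.

  For uniqueness, write \<open>P, R, R\<^sup>T, W\<close> for the blocks of \<open>G\<^sup>T * G\<close>: the matrix \<open>W\<^sup>-\<^sup>1 * R\<^sup>T * P\<^sup>-\<^sup>1 * R\<close>
  is conjugate to the diagonal matrix of the \<open>(tanh (2 \<theta> i))\<^sup>2\<close>.\<close>

section \<open>Singular value decomposition\<close>

lemma scalar_prod_self_pos:
  fixes v :: "real vec"
  assumes "v \<in> carrier_vec n" "v \<noteq> 0\<^sub>v n"
  shows "0 < v \<bullet> v"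
proof -
  obtain i where i: "i < n" "v $ i \<noteq> 0"
    using assms by (metis carrier_vecD eq_vecI index_zero_vec)
  have "0 < (\<Sum>j\<in>{0..<n}. v $ j * v $ j)"
    by (rule sum_pos2[of _ i]) (use i in \<open>auto simp: zero_less_mult_iff linorder_neq_iff\<close>)
  then show ?thesis
    using assms by (simp add: scalar_prod_def)
qed

lemma unit_vec_in_direction:
  fixes v :: "real vec"
  assumes v: "v \<in> carrier_vec n" "v \<noteq> 0\<^sub>v n"
  obtains a where "a \<noteq> 0" "(a \<cdot>\<^sub>v v) \<bullet> (a \<cdot>\<^sub>v v) = 1"
proof
  have pos: "0 < v \<bullet> v"
    using v by (rule scalar_prod_self_pos)
  then show "1 / sqrt (v \<bullet> v) \<noteq> 0" by simp
  have "(1 / sqrt (v \<bullet> v)) * (1 / sqrt (v \<bullet> v)) = 1 / (v \<bullet> v)"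
    using pos by simp
  then show "(1 / sqrt (v \<bullet> v) \<cdot>\<^sub>v v) \<bullet> (1 / sqrt (v \<bullet> v) \<cdot>\<^sub>v v) = 1"
    using v pos by (simp add: smult_scalar_prod_distrib[of _ n] scalar_prod_smult_distrib[of _ n])
qed

lemma scalar_prod_mult_mat_vec:
  fixes A :: "real mat"
  assumes "A \<in> carrier_mat m n" "v \<in> carrier_vec n" "w \<in> carrier_vec m"
  shows "(A *\<^sub>v v) \<bullet> w = v \<bullet> (transpose_mat A *\<^sub>v w)"
  using transpose_vec_mult_scalar[OF assms] comm_scalar_prod[of "A *\<^sub>v v" m w]
    comm_scalar_prod[of "transpose_mat A *\<^sub>v w" n v] assms by simp

text \<open>Over the complex numbers an eigenvector \<open>z\<close> exists as soon as the dimension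
  is positive. Symmetry forces its eigenvalue to be real, and then the real and imaginary parts of
  \<open>z\<close> both satisfy the eigenvector equation; at least one of them is nonzero.\<close>

lemma real_symmetric_eigenvector:
  fixes M :: "real mat"
  assumes M: "M \<in> carrier_mat n n" and sym: "transpose_mat M = M" and n: "n > 0"
  obtains v l where "v \<in> carrier_vec n" "v \<noteq> 0\<^sub>v n" "M *\<^sub>v v = l \<cdot>\<^sub>v v"
proof -
  define C where "C = map_mat complex_of_real M"
  have C: "C \<in> carrier_mat n n"
    using M by (simp add: C_def)
  obtain l z where "eigenvector C z l"
    using spectrum_non_empty[OF C n] by (auto simp: spectrum_def eigenvalue_def)
  then have z: "z \<in> carrier_vec n" "z \<noteq> 0\<^sub>v n" "C *\<^sub>v z = l \<cdot>\<^sub>v z"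
    using C by (auto simp: eigenvector_def)
  define a b where "a = map_vec Re z" and "b = map_vec Im z"
  have ab: "a \<in> carrier_vec n" "b \<in> carrier_vec n"
    using z by (auto simp: a_def b_def)
  have row: "(\<Sum>j\<in>{0..<n}. complex_of_real (M $$ (i, j)) * z $ j) = l * z $ i" if "i < n" for i
    using arg_cong[OF z(3), of "\<lambda>x. x $ i"] that C M z by (simp add: scalar_prod_def C_def)
  have Ma: "M *\<^sub>v a = Re l \<cdot>\<^sub>v a - Im l \<cdot>\<^sub>v b"
    by (intro eq_vecI) (use M z arg_cong[OF row, of _ Re] in \<open>auto simp: scalar_prod_def a_def b_def\<close>)
  have Mb: "M *\<^sub>v b = Im l \<cdot>\<^sub>v a + Re l \<cdot>\<^sub>v b"
    by (intro eq_vecI) (use M z arg_cong[OF row, of _ Im] in \<open>auto simp: scalar_prod_def a_def b_def\<close>)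
  \<comment> \<open>Inserting \<open>Ma\<close> and \<open>Mb\<close>, the multiples of
    \<open>Re l\<close> cancel and \<open>Im l\<close> times the sum of the squared norms of
    \<open>a\<close> and \<open>b\<close> remains.\<close>
  have "(M *\<^sub>v a) \<bullet> b = a \<bullet> (M *\<^sub>v b)"
    using scalar_prod_mult_mat_vec[OF M ab] sym by simp
  then have "Im l * (a \<bullet> a + b \<bullet> b) = 0"
    using ab comm_scalar_prod[OF ab] unfolding Ma Mb
    by (simp add: minus_scalar_prod_distrib[of _ n] scalar_prod_add_distrib[of _ n] algebra_simps)
  moreover have nz: "a \<noteq> 0\<^sub>v n \<or> b \<noteq> 0\<^sub>v n"
  proof (rule ccontr)
    assume "\<not> ?thesis"
    then have "Re (z $ i) = 0 \<and> Im (z $ i) = 0" if "i < n" for i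
      using that z a_def b_def index_map_vec(1)[of i z Re] index_map_vec(1)[of i z Im] by simp
    then show False
      using z by (metis carrier_vecD complex_eqI eq_vecI index_zero_vec zero_complex.sel)
  qed
  then have "a \<bullet> a + b \<bullet> b \<noteq> 0"
    using scalar_prod_self_pos[OF ab(1)] scalar_prod_self_pos[OF ab(2)] ab
    by (cases "a = 0\<^sub>v n"; cases "b = 0\<^sub>v n") auto
  ultimately have "Im l = 0" by simp
  then have "M *\<^sub>v a = Re l \<cdot>\<^sub>v a" "M *\<^sub>v b = Re l \<cdot>\<^sub>v b"
    using Ma Mb ab by (auto intro!: eq_vecI)
  then show thesis
    using nz ab that by blast
qed

section \<open>Orthogonal matrices and Householder reflections\<close>

lemma orthogonal_groupD:
  assumes "Q \<in> orthogonal_group n"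
  shows "Q \<in> carrier_mat n n" "transpose_mat Q * Q = 1\<^sub>m n" "Q * transpose_mat Q = 1\<^sub>m n"
  using assms mat_mult_left_right_inverse[of "transpose_mat Q" n Q]
  by (auto simp: orthogonal_group_def)

lemma orthogonal_group_mult:
  assumes "Q \<in> orthogonal_group n" "R \<in> orthogonal_group n"
  shows "Q * R \<in> orthogonal_group n"
proof -
  note [simp] = orthogonal_groupD[OF assms(1)] orthogonal_groupD[OF assms(2)]
  have "transpose_mat Q * (Q * R) = R"
    using assoc_mult_mat[of "transpose_mat Q" n n Q n R n] left_mult_one_mat[of R n n] by simp
  then have "transpose_mat (Q * R) * (Q * R) = 1\<^sub>m n"
    using assoc_mult_mat[of "transpose_mat R" n n "transpose_mat Q" n "Q * R" n] mult_carrier_mat[of Q n n R n]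
    by (simp add: transpose_mult[of Q n n R n])
  then show ?thesis
    using mult_carrier_mat[of Q n n R n] by (simp add: orthogonal_group_def)
qed

text \<open>The Householder reflection exchanging \<open>v\<close> and the first unit vector. For \<open>v\<close> equal to the latter,
  the factor \<open>2 / (w \<bullet> w)\<close> is \<open>0\<close> and the matrix below is the identity.\<close>

lemma orthogonal_with_first_column:
  fixes v :: "real vec"
  assumes v: "v \<in> carrier_vec n" "v \<bullet> v = 1" and n: "n > 0"
  obtains Q where "Q \<in> orthogonal_group n" "col Q 0 = v"
proof
  define w where "w = v - unit_vec n 0"
  define c where "c = 2 / (w \<bullet> w)"
  define Q where "Q = mat n n (\<lambda>(i,j). (if i = j then 1 else 0) - c * w $ i * w $ j)"
  have w: "w \<in> carrier_vec n" using v by (simp add: w_def)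
  have wi: "w $ i = v $ i - (if i = 0 then 1 else 0)" if "i < n" for i
    using that v n by (simp add: w_def)
  have ww: "w \<bullet> w = 2 - 2 * v $ 0"
    using v n by (simp add: w_def minus_scalar_prod_distrib[of _ n] scalar_prod_minus_distrib[of _ n])
  \<comment> \<open>This identity makes the quadratic term of \<open>transpose_mat Q * Q\<close>
    cancel the two linear ones. It also covers \<open>w = 0\<close>, where both sides are
    \<open>0\<close>.\<close>
  have cc: "c * c * (w \<bullet> w) = 2 * c"
    by (simp add: c_def)
  have "(transpose_mat Q * Q) $$ (i, j) = (1\<^sub>m n) $$ (i, j)" if ij: "i < n" "j < n" for i j
  proof -
    have "(transpose_mat Q * Q) $$ (i, j) = (\<Sum>k\<in>{0..<n}.
        ((if k = i then 1 else 0) - c * w $ k * w $ i) * ((if k = j then 1 else 0) - c * w $ k * w $ j))"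
      using ij by (simp add: Q_def scalar_prod_def)
    also have "\<dots> = (\<Sum>k\<in>{0..<n}. (if k = i then (if i = j then 1 else 0) - c * w $ i * w $ j else 0)
        - (if k = j then c * w $ i * w $ j else 0) + c * c * w $ i * w $ j * (w $ k * w $ k))"
      by (rule sum.cong) (auto simp: algebra_simps)
    also have "\<dots> = (if i = j then 1 else 0) - 2 * (c * w $ i * w $ j) + c * c * w $ i * w $ j * (w \<bullet> w)"
      using ij w by (simp add: sum.distrib sum_subtractf sum_distrib_left[symmetric] scalar_prod_def)
    also have "c * c * w $ i * w $ j * (w \<bullet> w) = (c * c * (w \<bullet> w)) * (w $ i * w $ j)"
      by simp
    also have "\<dots> = 2 * (c * w $ i * w $ j)"
      unfolding cc by simp
    finally show ?thesis using ij by simp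
  qed
  then show "Q \<in> orthogonal_group n"
    by (auto simp: orthogonal_group_def Q_def intro!: eq_matI)
  \<comment> \<open>As \<open>v\<close> is a unit vector, \<open>w \<bullet> w\<close> is
    \<open>2 * (1 - v $ 0)\<close>, so \<open>c * w $ 0 = - 1\<close> unless \<open>w\<close>
    vanishes. Column 0 of \<open>Q\<close> is the first unit vector minus \<open>c * w $ 0\<close>
    times \<open>w\<close>, hence \<open>v\<close>.\<close>
  have "c * (v $ 0 - 1) = - 1 \<or> w = 0\<^sub>v n"
    using scalar_prod_self_pos[OF w] ww by (auto simp: c_def field_simps)
  then show "col Q 0 = v"
  proof
    assume "c * (v $ 0 - 1) = - 1"
    then have "w $ i * (c * (v $ 0 - 1)) = - w $ i" for i
      by simp
    then have "c * w $ i * (v $ 0 - 1) = - w $ i" for i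
      by (simp only: ac_simps)
    then show ?thesis
      using v n by (intro eq_vecI) (auto simp: Q_def wi)
  next
    assume "w = 0\<^sub>v n"
    then have "v $ i = (if i = 0 then 1 else 0)" if "i < n" for i
      using wi[OF that] that by simp
    moreover have "w $ i = 0" if "i < n" for i
      using \<open>w = 0\<^sub>v n\<close> that by simp
    ultimately show ?thesis
      using v n by (intro eq_vecI) (auto simp: Q_def)
  qed
qed

section \<open>Pairs of singular vectors\<close>

text \<open>Padding \<open>T\<close> with zero columns gives a square matrix \<open>S\<close>, and
  padding \<open>v\<close> with zeros gives a kernel vector of \<open>S\<close>. So \<open>S\<close>
  and its transpose have determinant \<open>0\<close>; a kernel vector of the latter is killed by
  its first \<open>q\<close> rows, which form the transpose of \<open>T\<close>.\<close>

lemma kernel_transpose_nontrivial: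
  fixes T :: "real mat"
  assumes T: "T \<in> carrier_mat p q" and qp: "q \<le> p"
    and v: "v \<in> carrier_vec q" "v \<noteq> 0\<^sub>v q" "T *\<^sub>v v = 0\<^sub>v p"
  obtains u where "u \<in> carrier_vec p" "u \<noteq> 0\<^sub>v p" "transpose_mat T *\<^sub>v u = 0\<^sub>v q"
proof -
  define S where "S = mat p p (\<lambda>(i,j). if j < q then T $$ (i,j) else 0)"
  define x where "x = vec p (\<lambda>i. if i < q then v $ i else 0)"
  have S: "S \<in> carrier_mat p p" by (simp add: S_def)
  have set: "{0..<p} \<inter> {j. j < q} = {0..<q}" using qp by auto
  have "S *\<^sub>v x = 0\<^sub>v p"
  proof (intro eq_vecI)
    fix i assume i: "i < dim_vec (0\<^sub>v p :: real vec)"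
    have "(S *\<^sub>v x) $ i = (\<Sum>j\<in>{0..<p}. if j < q then T $$ (i,j) * v $ j else 0)"
      using i by (auto simp: S_def x_def scalar_prod_def intro!: sum.cong)
    also have "\<dots> = (T *\<^sub>v v) $ i"
      using i T v(1) by (simp add: scalar_prod_def sum.If_cases set)
    finally show "(S *\<^sub>v x) $ i = 0\<^sub>v p $ i" using v(3) by simp
  qed (simp add: S_def)
  moreover obtain k where k: "k < q" "v $ k \<noteq> 0"
    using v by (metis carrier_vecD eq_vecI index_zero_vec)
  have "x $ k \<noteq> 0\<^sub>v p $ k"
    using k qp by (simp add: x_def)
  then have "x \<noteq> 0\<^sub>v p" by auto
  moreover have "x \<in> carrier_vec p" by (simp add: x_def)
  ultimately have "det S = 0"
    using det_0_iff_vec_prod_zero[OF S] by blast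
  then have "det (transpose_mat S) = 0" by (simp add: det_transpose[OF S])
  then obtain u where u: "u \<in> carrier_vec p" "u \<noteq> 0\<^sub>v p" "transpose_mat S *\<^sub>v u = 0\<^sub>v p"
    using det_0_iff_vec_prod_zero[of "transpose_mat S" p] S by auto
  have "transpose_mat T *\<^sub>v u = 0\<^sub>v q"
  proof (intro eq_vecI)
    fix i assume i: "i < dim_vec (0\<^sub>v q :: real vec)"
    then show "(transpose_mat T *\<^sub>v u) $ i = 0\<^sub>v q $ i"
      using arg_cong[OF u(3), of "\<lambda>x. x $ i"] T qp u(1) by (simp add: S_def scalar_prod_def)
  qed (use T in auto)
  with u show thesis using that by blast
qed

text \<open>Take an eigenvector \<open>v\<close> of \<open>transpose_mat T * T\<close>. If
  \<open>T *\<^sub>v v\<close> is nonzero, its normalisation serves as \<open>u\<close>; otherwise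
  \<open>s = 0\<close> and \<open>u\<close> is taken from the kernel of the transpose, which is
  nontrivial because \<open>q \<le> p\<close>.\<close>

lemma singular_vectors:
  fixes T :: "real mat"
  assumes T: "T \<in> carrier_mat p q" and qp: "q \<le> p" and q: "q > 0"
  obtains u v s where "u \<in> carrier_vec p" "u \<bullet> u = 1" "v \<in> carrier_vec q" "v \<bullet> v = 1"
    "T *\<^sub>v v = s \<cdot>\<^sub>v u" "transpose_mat T *\<^sub>v u = s \<cdot>\<^sub>v v"
proof -
  have TT: "transpose_mat T * T \<in> carrier_mat q q" using T by simp
  have "transpose_mat (transpose_mat T * T) = transpose_mat T * T"
    using T by (simp add: transpose_mult[of _ q p _ q])
  then obtain v l where v: "v \<in> carrier_vec q" "v \<noteq> 0\<^sub>v q" "(transpose_mat T * T) *\<^sub>v v = l \<cdot>\<^sub>v v"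
    using real_symmetric_eigenvector[OF TT _ q] by blast
  have eig: "transpose_mat T *\<^sub>v (T *\<^sub>v v) = l \<cdot>\<^sub>v v"
    using assoc_mult_mat_vec[of "transpose_mat T" q p T q v] v T by simp
  obtain a where a: "a \<noteq> 0" "(a \<cdot>\<^sub>v v) \<bullet> (a \<cdot>\<^sub>v v) = 1"
    using unit_vec_in_direction[OF v(1,2)] by blast
  show thesis
  proof (cases "T *\<^sub>v v = 0\<^sub>v p")
    case True
    obtain u where u: "u \<in> carrier_vec p" "u \<noteq> 0\<^sub>v p" "transpose_mat T *\<^sub>v u = 0\<^sub>v q"
      using kernel_transpose_nontrivial[OF T qp v(1,2) True] by blast
    obtain b where b: "b \<noteq> 0" "(b \<cdot>\<^sub>v u) \<bullet> (b \<cdot>\<^sub>v u) = 1"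
      using unit_vec_in_direction[OF u(1,2)] by blast
    have "T *\<^sub>v (a \<cdot>\<^sub>v v) = 0 \<cdot>\<^sub>v (b \<cdot>\<^sub>v u)" "transpose_mat T *\<^sub>v (b \<cdot>\<^sub>v u) = 0 \<cdot>\<^sub>v (a \<cdot>\<^sub>v v)"
      using True u v T by (auto simp: mult_mat_vec[of _ p q] mult_mat_vec[of _ q p])
    then show thesis
      using that[of "b \<cdot>\<^sub>v u" "a \<cdot>\<^sub>v v" 0] a b u v by simp
  next
    case False
    have Tv: "T *\<^sub>v v \<in> carrier_vec p" using T v by simp
    obtain b where b: "b \<noteq> 0" "(b \<cdot>\<^sub>v (T *\<^sub>v v)) \<bullet> (b \<cdot>\<^sub>v (T *\<^sub>v v)) = 1"
      using unit_vec_in_direction[OF Tv False] by blast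
    \<comment> \<open>With \<open>a\<close> and \<open>b\<close> the normalising factors of
      \<open>v\<close> and \<open>T *\<^sub>v v\<close>, this gives
      \<open>b * b * l = a * a\<close>. Hence the same number \<open>a / b\<close> works as singular
      value in both equations.\<close>
    have "(T *\<^sub>v v) \<bullet> (T *\<^sub>v v) = l * (v \<bullet> v)"
      using scalar_prod_mult_mat_vec[OF T v(1) Tv] eig v by simp
    then have "b * b * l * (v \<bullet> v) = 1" "a * a * (v \<bullet> v) = 1"
      using a b v Tv by (auto simp: smult_scalar_prod_distrib[of _ q] scalar_prod_smult_distrib[of _ q]
        smult_scalar_prod_distrib[of _ p] scalar_prod_smult_distrib[of _ p] algebra_simps)
    then have "b * b * l * (v \<bullet> v) = a * a * (v \<bullet> v)" "v \<bullet> v \<noteq> 0"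
      by auto
    then have "b * b * l = a * a"
      by simp
    then have "b * l = a / b * a"
      using b by (simp add: field_simps)
    then have "transpose_mat T *\<^sub>v (b \<cdot>\<^sub>v (T *\<^sub>v v)) = (a / b) \<cdot>\<^sub>v (a \<cdot>\<^sub>v v)"
      using T Tv v eig by (simp add: mult_mat_vec[of _ q p] smult_smult_assoc)
    moreover have "T *\<^sub>v (a \<cdot>\<^sub>v v) = (a / b) \<cdot>\<^sub>v (b \<cdot>\<^sub>v (T *\<^sub>v v))"
      using T v b by (simp add: mult_mat_vec[of _ p q] smult_smult_assoc)
    ultimately show thesis
      using that[of "b \<cdot>\<^sub>v (T *\<^sub>v v)" "a \<cdot>\<^sub>v v" "a / b"] a b Tv v by simp
  qed
qed

section \<open>Invertible real matrices\<close>

lemma det_nonzero_inverse: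
  fixes A :: "real mat"
  assumes A: "A \<in> carrier_mat n n" "det A \<noteq> 0"
  obtains B where "B \<in> carrier_mat n n" "B * A = 1\<^sub>m n" "A * B = 1\<^sub>m n"
proof -
  have "A \<in> Units (ring_mat TYPE(real) n ())"
    by (rule det_non_zero_imp_unit[OF A])
  then show thesis
    using that by (auto simp: Units_def ring_mat_def)
qed

text \<open>With determinants, closure under products and transposes and the passage to factors or
  diagonal blocks are immediate.\<close>

lemma GL_real_iff: "A \<in> GL_real n \<longleftrightarrow> A \<in> carrier_mat n n \<and> det A \<noteq> 0"
proof
  assume A: "A \<in> GL_real n"
  then obtain B where B: "A * B = 1\<^sub>m n" "B * A = 1\<^sub>m (dim_row B)" "A \<in> carrier_mat n n"
    by (auto simp: GL_real_def invertible_mat_def inverts_mat_def)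
  \<comment> \<open>The definition of invertibility leaves the size of \<open>B\<close> open;
    comparing the column numbers in the two identities fixes it.\<close>
  have "dim_row B = n" "dim_col B = n"
    using arg_cong[OF B(2), of dim_col] arg_cong[OF B(1), of dim_col] B(3) by auto
  then have "det A * det B = 1"
    using det_mult[of A n B] carrier_matI[of B n n] B by simp
  with B(3) show "A \<in> carrier_mat n n \<and> det A \<noteq> 0" by auto
next
  assume A: "A \<in> carrier_mat n n \<and> det A \<noteq> 0"
  then obtain B where B: "B \<in> carrier_mat n n" "B * A = 1\<^sub>m n" "A * B = 1\<^sub>m n"
    using det_nonzero_inverse by metis
  then have "inverts_mat A B \<and> inverts_mat B A"
    using A by (auto simp: inverts_mat_def)
  then show "A \<in> GL_real n"
    using A by (auto simp: GL_real_def invertible_mat_def)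
qed

lemma GL_real_leftI:
  assumes "A \<in> carrier_mat n n" "B \<in> carrier_mat n n" "B * A = 1\<^sub>m n"
  shows "A \<in> GL_real n"
proof -
  have "det B * det A = 1"
    using det_mult[OF assms(2,1)] assms(3) by simp
  then show ?thesis
    using assms(1) by (auto simp: GL_real_iff)
qed

lemma GL_real_inverse:
  assumes "A \<in> GL_real n"
  obtains B where "B \<in> GL_real n" "B * A = 1\<^sub>m n" "A * B = 1\<^sub>m n"
proof -
  have A: "A \<in> carrier_mat n n" "det A \<noteq> 0"
    using assms by (auto simp: GL_real_iff)
  obtain B where B: "B \<in> carrier_mat n n" "B * A = 1\<^sub>m n" "A * B = 1\<^sub>m n"
    using det_nonzero_inverse[OF A] by blast
  with that[of B] GL_real_leftI[OF B(1) A(1) B(3)] show thesis by blast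
qed

lemma GL_real_mult:
  assumes "A \<in> GL_real n" "B \<in> GL_real n"
  shows "A * B \<in> GL_real n"
  using assms mult_carrier_mat[of A n n B n] by (simp add: GL_real_iff det_mult[of A n B])

lemma GL_real_transpose:
  assumes "A \<in> GL_real n"
  shows "transpose_mat A \<in> GL_real n"
  using assms by (simp add: GL_real_iff det_transpose[of A n])

lemma GL_real_mult_cancel:
  assumes "A * B \<in> GL_real n" "A \<in> carrier_mat n n" "B \<in> carrier_mat n n"
  shows "A \<in> GL_real n" "B \<in> GL_real n"
  using assms by (auto simp: GL_real_iff det_mult[of A n B])

lemma orthogonal_group_GL_real:
  assumes "Q \<in> orthogonal_group n"
  shows "Q \<in> GL_real n"
  using orthogonal_groupD[OF assms] by (intro GL_real_leftI[of Q n "transpose_mat Q"]) auto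

text \<open>The library versions have \<open>carrier_mat\<close> premises with dimensions that do not occur in the
  conclusion, so the simplifier cannot discharge them.\<close>

lemma assoc_mult_mat_dim:
  fixes A B C :: "real mat"
  assumes "dim_col A = dim_row B" "dim_col B = dim_row C"
  shows "A * B * C = A * (B * C)"
  using assms by (intro assoc_mult_mat[of A "dim_row A" "dim_row B" B "dim_row C" C "dim_col C"]) auto

lemma transpose_mult_dim:
  fixes A B :: "real mat"
  assumes "dim_col A = dim_row B"
  shows "transpose_mat (A * B) = transpose_mat B * transpose_mat A"
  using assms by (intro transpose_mult[of A "dim_row A" "dim_row B" B "dim_col B"]) auto

section \<open>Block diagonal matrices\<close>

text \<open>The zero blocks take their sizes from \<open>A\<close> and \<open>B\<close>, so the
  diagonal blocks may be rectangular, as the deflation of a non-square matrix requires.\<close>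

definition block_diag :: "real mat \<Rightarrow> real mat \<Rightarrow> real mat" where
  "block_diag A B =
     four_block_mat A (0\<^sub>m (dim_row A) (dim_col B)) (0\<^sub>m (dim_row B) (dim_col A)) B"

lemma block_diag_dim [simp]:
  "dim_row (block_diag A B) = dim_row A + dim_row B"
  "dim_col (block_diag A B) = dim_col A + dim_col B"
  by (simp_all add: block_diag_def)

lemma block_diag_mult_four_block:
  assumes "X \<in> carrier_mat m1 n1" "Y \<in> carrier_mat m2 n2" "A \<in> carrier_mat n1 k1"
    "B \<in> carrier_mat n1 k2" "C \<in> carrier_mat n2 k1" "D \<in> carrier_mat n2 k2"
  shows "block_diag X Y * four_block_mat A B C D
    = four_block_mat (X * A) (X * B) (Y * C) (Y * D)"
proof -
  note [simp] = mult_carrier_mat[OF assms(1,3)] mult_carrier_mat[OF assms(1,4)]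
    mult_carrier_mat[OF assms(2,5)] mult_carrier_mat[OF assms(2,6)]
  show ?thesis
    using assms by (simp add: block_diag_def mult_four_block_mat[of X m1 n1 _ n2 _ m2 Y A k1 B k2 C D])
qed

lemma four_block_mult_block_diag:
  assumes "X \<in> carrier_mat k1 m1" "Y \<in> carrier_mat k2 m2" "A \<in> carrier_mat n1 k1"
    "B \<in> carrier_mat n1 k2" "C \<in> carrier_mat n2 k1" "D \<in> carrier_mat n2 k2"
  shows "four_block_mat A B C D * block_diag X Y
    = four_block_mat (A * X) (B * Y) (C * X) (D * Y)"
proof -
  note [simp] = mult_carrier_mat[OF assms(3,1)] mult_carrier_mat[OF assms(4,2)]
    mult_carrier_mat[OF assms(5,1)] mult_carrier_mat[OF assms(6,2)]
  show ?thesis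
    using assms by (simp add: block_diag_def mult_four_block_mat[of A n1 k1 B k2 C n2 D X m1 _ m2 _ Y])
qed

lemma transpose_block_diag:
  "transpose_mat (block_diag A B) = block_diag (transpose_mat A) (transpose_mat B)"
  by (simp add: block_diag_def
      transpose_four_block_mat[of A "dim_row A" "dim_col A" _ "dim_col B" _ "dim_row B"])

lemma block_diag_mult:
  assumes "dim_col A = dim_row C" "dim_col B = dim_row D"
  shows "block_diag A B * block_diag C D = block_diag (A * C) (B * D)"
proof -
  have "block_diag A B * block_diag C D = block_diag (A * C) (B * D)"
    if "A \<in> carrier_mat m1 n1" "B \<in> carrier_mat m2 n2" "C \<in> carrier_mat n1 k1" "D \<in> carrier_mat n2 k2"
    for m1 n1 m2 n2 k1 k2
    using block_diag_mult_four_block[OF that(1,2,3) _ _ that(4), of "0\<^sub>m n1 k2" "0\<^sub>m n2 k1"] that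
    by (simp add: block_diag_def[of C D] block_diag_def[of "A * C" "B * D"])
  then show ?thesis
    using assms by (metis carrier_mat_triv)
qed

lemma block_diag_carrier [simp]:
  assumes "A \<in> carrier_mat m1 n1" "B \<in> carrier_mat m2 n2"
  shows "block_diag A B \<in> carrier_mat (m1 + m2) (n1 + n2)"
  using assms by (simp add: block_diag_def)

lemma block_diag_one [simp]: "block_diag (1\<^sub>m m) (1\<^sub>m n) = 1\<^sub>m (m + n)"
  by (simp add: block_diag_def)

lemma block_diag_GL_real_iff:
  assumes "A \<in> carrier_mat m m" "B \<in> carrier_mat n n"
  shows "block_diag A B \<in> GL_real (m + n) \<longleftrightarrow> A \<in> GL_real m \<and> B \<in> GL_real n"
  using assms det_four_block_mat_upper_right_zero[of A m "0\<^sub>m m n" n "0\<^sub>m n m" B]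
  by (auto simp: GL_real_iff block_diag_def)

lemma block_diag_orthogonal:
  assumes "Q \<in> orthogonal_group m" "R \<in> orthogonal_group n"
  shows "block_diag Q R \<in> orthogonal_group (m + n)"
  using orthogonal_groupD[OF assms(1)] orthogonal_groupD[OF assms(2)]
  by (simp add: orthogonal_group_def transpose_block_diag block_diag_mult)

section \<open>Rectangular diagonal matrices and the singular value decomposition\<close>

definition rect_diag :: "nat \<Rightarrow> nat \<Rightarrow> (nat \<Rightarrow> real) \<Rightarrow> real mat" where
  "rect_diag p q s = mat p q (\<lambda>(i,j). if i = j then s i else 0)"

lemma rect_diag_carrier [simp]: "rect_diag p q s \<in> carrier_mat p q"
  by (simp add: rect_diag_def)

lemma rect_diag_dim [simp]:
  "dim_row (rect_diag p q s) = p" "dim_col (rect_diag p q s) = q"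
  by (simp_all add: rect_diag_def)

lemma rect_diag_cong:
  assumes "\<And>i. i < p \<Longrightarrow> i < q \<Longrightarrow> s i = t i"
  shows "rect_diag p q s = rect_diag p q t"
  using assms by (intro eq_matI) (auto simp: rect_diag_def)

lemma transpose_rect_diag [simp]: "transpose_mat (rect_diag p q s) = rect_diag q p s"
  by (intro eq_matI) (auto simp: rect_diag_def)

text \<open>A diagonal entry survives only if its index also exists in the inner dimension
  \<open>n\<close>; this is what the case distinction records.\<close>

lemma rect_diag_mult:
  "rect_diag p n s * rect_diag n q t = rect_diag p q (\<lambda>i. if i < n then s i * t i else 0)"
proof (intro eq_matI)
  fix i j assume "i < dim_row (rect_diag p q (\<lambda>i. if i < n then s i * t i else 0))"
    "j < dim_col (rect_diag p q (\<lambda>i. if i < n then s i * t i else 0))"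
  then have ij: "i < p" "j < q" by auto
  then have "(rect_diag p n s * rect_diag n q t) $$ (i, j)
      = (\<Sum>k\<in>{0..<n}. (if i = k then s i else 0) * (if k = j then t k else 0))"
    by (simp add: rect_diag_def scalar_prod_def)
  also have "\<dots> = (\<Sum>k\<in>{0..<n}. if k = i then (if i = j then s i * t i else 0) else 0)"
    by (rule sum.cong) auto
  finally show "(rect_diag p n s * rect_diag n q t) $$ (i, j)
      = rect_diag p q (\<lambda>i. if i < n then s i * t i else 0) $$ (i, j)"
    using ij by (simp add: rect_diag_def)
qed auto

lemma rect_diag_add:
  "rect_diag p q s + rect_diag p q t = rect_diag p q (\<lambda>i. s i + t i)"
  by (intro eq_matI) (auto simp: rect_diag_def)

lemma rect_diag_one: "rect_diag n n (\<lambda>i. 1) = 1\<^sub>m n"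
  by (intro eq_matI) (auto simp: rect_diag_def)

lemma rect_diag_zero: "rect_diag p q (\<lambda>i. 0) = 0\<^sub>m p q"
  by (intro eq_matI) (auto simp: rect_diag_def)

text \<open>Deflation, by induction on \<open>q\<close>: complete a pair of singular vectors to
  orthogonal matrices \<open>U\<close> and \<open>V\<close>. Then
  \<open>transpose_mat U * T * V\<close> has \<open>s\<close> in the corner and zeros in the rest of
  its first row and column, and the induction hypothesis applies to the remaining block. The values
  obtained are neither ordered nor required to be nonnegative.\<close>

theorem singular_value_decomposition:
  fixes T :: "real mat"
  assumes "T \<in> carrier_mat p q" "q \<le> p"
  shows "\<exists>U V s. U \<in> orthogonal_group p \<and> V \<in> orthogonal_group q
    \<and> transpose_mat U * T * V = rect_diag p q s"
  using assms
proof (induction q arbitrary: p T)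
  case 0
  have "1\<^sub>m k \<in> orthogonal_group k" for k by (simp add: orthogonal_group_def)
  moreover have "transpose_mat (1\<^sub>m p) * T * 1\<^sub>m 0 = rect_diag p 0 (\<lambda>_. 0)"
    using 0 by (intro eq_matI) (auto simp: rect_diag_def)
  ultimately show ?case by blast
next
  case (Suc q)
  note T = Suc.prems(1)
  from Suc.prems(2) obtain p' where p: "p = Suc p'" "q \<le> p'" by (cases p) auto
  obtain u v s where uv: "u \<in> carrier_vec p" "u \<bullet> u = 1" "v \<in> carrier_vec (Suc q)" "v \<bullet> v = 1"
      "T *\<^sub>v v = s \<cdot>\<^sub>v u" "transpose_mat T *\<^sub>v u = s \<cdot>\<^sub>v v"
    using singular_vectors[OF T Suc.prems(2)] by auto
  obtain U where U: "U \<in> orthogonal_group p" "col U 0 = u"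
    using orthogonal_with_first_column[OF uv(1,2)] p by auto
  obtain V where V: "V \<in> orthogonal_group (Suc q)" "col V 0 = v"
    using orthogonal_with_first_column[OF uv(3,4)] by auto
  note Uc = orthogonal_groupD[OF U(1)] and Vc = orthogonal_groupD[OF V(1)]
  define S where "S = transpose_mat U * T * V"
  have S: "S \<in> carrier_mat p (Suc q)"
    unfolding S_def using mult_carrier_mat[OF mult_carrier_mat[OF _ T] Vc(1)] Uc(1) by simp
  have ind: "col U i \<bullet> u = (if i = 0 then 1 else 0)" if "i < p" for i
    using arg_cong[OF Uc(2), of "\<lambda>M. M $$ (i, 0)"] that Uc(1) U(2) p by simp
  have indV: "v \<bullet> col V j = (if j = 0 then 1 else 0)" if "j < Suc q" for j
    using arg_cong[OF Vc(2), of "\<lambda>M. M $$ (0, j)"] that Vc(1) V(2) by auto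
  have entry: "S $$ (i, j) = col U i \<bullet> (T *\<^sub>v col V j)" if "i < p" "j < Suc q" for i j
  proof -
    have "S = transpose_mat U * (T * V)"
      unfolding S_def using Uc Vc T assoc_mult_mat[of "transpose_mat U" p p T "Suc q" V "Suc q"] by simp
    then show ?thesis
      using that Uc(1) Vc(1) T by (simp add: mult_mat_vec_def)
  qed
  \<comment> \<open>The first column comes from \<open>T *\<^sub>v v = s \<cdot>\<^sub>v u\<close>
    and the orthonormality of the columns of \<open>U\<close>; the first row below comes from the
    dual equation for the transpose.\<close>
  have col0: "S $$ (i, 0) = (if i = 0 then s else 0)" if "i < p" for i
  proof -
    have "col U i \<in> carrier_vec p" using Uc(1) col_dim[of U i] by simp
    then have "col U i \<bullet> (s \<cdot>\<^sub>v u) = s * (col U i \<bullet> u)" using uv(1) by simp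
    then show ?thesis
      using entry[OF that, of 0] ind[OF that] uv(5) V(2) by simp
  qed
  have row0: "S $$ (0, j) = (if j = 0 then s else 0)" if "j < Suc q" for j
  proof -
    have cj: "col V j \<in> carrier_vec (Suc q)" using Vc(1) col_dim[of V j] by simp
    have "S $$ (0, j) = (T *\<^sub>v col V j) \<bullet> u"
      using entry[of 0 j] that p U(2) comm_scalar_prod[OF uv(1), of "T *\<^sub>v col V j"] T cj by simp
    also have "\<dots> = col V j \<bullet> (s \<cdot>\<^sub>v v)"
      using scalar_prod_mult_mat_vec[OF T cj uv(1)] uv(6) by simp
    also have "\<dots> = s * (v \<bullet> col V j)"
      using cj uv(3) comm_scalar_prod[OF cj uv(3)] by simp
    finally show ?thesis using indV[OF that] by simp
  qed
  define T' where "T' = mat p' q (\<lambda>(i,j). S $$ (Suc i, Suc j))"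
  have T': "T' \<in> carrier_mat p' q" by (simp add: T'_def)
  define E where "E = mat 1 1 (\<lambda>_. s)"
  have E: "E \<in> carrier_mat 1 1" by (simp add: E_def)
  have S_block: "S = block_diag E T'"
    by (intro eq_matI) (use S p in \<open>auto simp: block_diag_def E_def T'_def col0 row0\<close>)
  obtain U' V' s' where IH: "U' \<in> orthogonal_group p'" "V' \<in> orthogonal_group q"
      "transpose_mat U' * T' * V' = rect_diag p' q s'"
    using Suc.IH[OF T' p(2)] by blast
  note U'c = orthogonal_groupD[OF IH(1)] and V'c = orthogonal_groupD[OF IH(2)]
  have one: "1\<^sub>m 1 \<in> orthogonal_group 1" by (simp add: orthogonal_group_def)
  define U2 where "U2 = block_diag (1\<^sub>m 1) U'"
  define V2 where "V2 = block_diag (1\<^sub>m 1) V'"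
  have U2: "U2 \<in> orthogonal_group p"
    using block_diag_orthogonal[OF one IH(1)] p by (simp add: U2_def)
  have V2: "V2 \<in> orthogonal_group (Suc q)"
    using block_diag_orthogonal[OF one IH(2)] by (simp add: V2_def)
  note U2c = orthogonal_groupD[OF U2] and V2c = orthogonal_groupD[OF V2]
  have "transpose_mat U2 * S * V2 = block_diag E (transpose_mat U' * T' * V')"
    using U'c(1) V'c(1) T' E
    by (simp add: S_block U2_def V2_def transpose_block_diag block_diag_mult)
  also have "\<dots> = block_diag E (rect_diag p' q s')"
    by (simp only: IH(3))
  \<comment> \<open>\<open>case_nat s s'\<close> puts the new value in front of those from the
    induction hypothesis.\<close>
  also have "\<dots> = rect_diag p (Suc q) (case_nat s s')"
    by (intro eq_matI) (auto simp: block_diag_def rect_diag_def E_def p split: nat.split)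
  finally have "transpose_mat (U * U2) * T * (V * V2) = rect_diag p (Suc q) (case_nat s s')"
    using T Uc(1) Vc(1) U2c(1) V2c(1)
    by (simp add: S_def transpose_mult_dim assoc_mult_mat_dim)
  then show ?case
    using orthogonal_group_mult[OF U(1) U2] orthogonal_group_mult[OF V(1) V2] by blast
qed

section \<open>Hyperbolic matrices and uniqueness\<close>

text \<open>For \<open>q \<le> p\<close> these matrices are closed under products and transposes, so
  identities between hyperbolic matrices and scalings reduce to scalar identities at each
  index.\<close>

definition diag_blocks ::
  "nat \<Rightarrow> nat \<Rightarrow> (nat \<Rightarrow> real) \<Rightarrow> (nat \<Rightarrow> real) \<Rightarrow> (nat \<Rightarrow> real) \<Rightarrow> (nat \<Rightarrow> real) \<Rightarrow> real mat" where
  "diag_blocks p q a b c d =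
     four_block_mat (rect_diag p p a) (rect_diag p q b) (rect_diag q p c) (rect_diag q q d)"

lemma diag_blocks_carrier [simp]: "diag_blocks p q a b c d \<in> carrier_mat (p + q) (p + q)"
  by (simp add: diag_blocks_def)

lemma diag_blocks_dim [simp]:
  "dim_row (diag_blocks p q a b c d) = p + q" "dim_col (diag_blocks p q a b c d) = p + q"
  by (simp_all add: diag_blocks_def)

lemma diag_blocks_cong:
  assumes "\<And>i. i < p \<Longrightarrow> a i = a' i"
    and "\<And>i. i < q \<Longrightarrow> b i = b' i" "\<And>i. i < q \<Longrightarrow> c i = c' i" "\<And>i. i < q \<Longrightarrow> d i = d' i"
  shows "diag_blocks p q a b c d = diag_blocks p q a' b' c' d'"
  unfolding diag_blocks_def by (intro cong_four_block_mat rect_diag_cong) (use assms in auto)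

lemma transpose_diag_blocks [simp]:
  "transpose_mat (diag_blocks p q a b c d) = diag_blocks p q a c b d"
  by (simp add: diag_blocks_def transpose_four_block_mat[of _ p p _ q _ q])

text \<open>Up to a permutation of coordinates, each \<open>i < q\<close> contributes the 2-by-2
  matrix with rows \<open>a i, b i\<close> and \<open>c i, d i\<close>, and each \<open>i\<close>
  from \<open>q\<close> to \<open>p - 1\<close> the scalar \<open>a i\<close>. The product is taken
  piece by piece; the scalar pieces explain the case distinction.\<close>

lemma diag_blocks_mult:
  assumes "q \<le> p"
  shows "diag_blocks p q a b c d * diag_blocks p q a' b' c' d'
    = diag_blocks p q (\<lambda>i. a i * a' i + (if i < q then b i * c' i else 0))
        (\<lambda>i. a i * b' i + b i * d' i) (\<lambda>i. c i * a' i + d i * c' i) (\<lambda>i. c i * b' i + d i * d' i)"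
proof -
  have "diag_blocks p q a b c d * diag_blocks p q a' b' c' d' = four_block_mat
      (rect_diag p p a * rect_diag p p a' + rect_diag p q b * rect_diag q p c')
      (rect_diag p p a * rect_diag p q b' + rect_diag p q b * rect_diag q q d')
      (rect_diag q p c * rect_diag p p a' + rect_diag q q d * rect_diag q p c')
      (rect_diag q p c * rect_diag p q b' + rect_diag q q d * rect_diag q q d')"
    unfolding diag_blocks_def by (rule mult_four_block_mat) (rule rect_diag_carrier)+
  then show ?thesis
    unfolding diag_blocks_def rect_diag_mult rect_diag_add
    by (auto intro!: cong_four_block_mat rect_diag_cong
        simp: assms less_le_trans[OF _ assms])
qed

lemma diag_blocks_one: "diag_blocks p q (\<lambda>i. 1) (\<lambda>i. 0) (\<lambda>i. 0) (\<lambda>i. 1) = 1\<^sub>m (p + q)"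
  by (simp add: diag_blocks_def rect_diag_one rect_diag_zero)

lemma block_diag_rect_diag:
  "block_diag (rect_diag p p a) (rect_diag q q d) = diag_blocks p q a (\<lambda>i. 0) (\<lambda>i. 0) d"
  by (simp add: diag_blocks_def block_diag_def rect_diag_zero)

lemma hyperbolic_mat_diag_blocks:
  assumes "q \<le> p"
  shows "hyperbolic_mat p q \<theta> = diag_blocks p q (\<lambda>i. if i < q then cosh (\<theta> i) else 1)
    (\<lambda>i. sinh (\<theta> i)) (\<lambda>i. sinh (\<theta> i)) (\<lambda>i. cosh (\<theta> i))"
  unfolding hyperbolic_mat_def diag_blocks_def Let_def
  by (intro cong_four_block_mat eq_matI) (use assms in \<open>auto simp: rect_diag_def mat_diag_def\<close>)

lemma hyperbolic_mat_carrier: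
  assumes "q \<le> p"
  shows "hyperbolic_mat p q \<theta> \<in> carrier_mat (p + q) (p + q)"
  by (simp add: hyperbolic_mat_diag_blocks[OF assms])

lemma transpose_hyperbolic_mat:
  assumes "q \<le> p"
  shows "transpose_mat (hyperbolic_mat p q \<theta>) = hyperbolic_mat p q \<theta>"
  by (simp add: hyperbolic_mat_diag_blocks[OF assms])

text \<open>These are the addition theorems of \<open>cosh\<close> and \<open>sinh\<close> at each
  index. In particular \<open>- \<theta>\<close> yields the inverse and
  \<open>\<theta> + \<theta>\<close> the square.\<close>

lemma hyperbolic_mat_mult:
  assumes "q \<le> p"
  shows "hyperbolic_mat p q \<theta> * hyperbolic_mat p q \<phi> = hyperbolic_mat p q (\<lambda>i. \<theta> i + \<phi> i)"
  unfolding hyperbolic_mat_diag_blocks[OF assms] diag_blocks_mult[OF assms]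
  by (rule diag_blocks_cong) (auto simp: cosh_add sinh_add algebra_simps)

lemma hyperbolic_mat_zero:
  assumes "q \<le> p"
  shows "hyperbolic_mat p q (\<lambda>i. 0) = 1\<^sub>m (p + q)"
  unfolding hyperbolic_mat_diag_blocks[OF assms] diag_blocks_one[symmetric]
  by (rule diag_blocks_cong) auto

section \<open>Gram matrices, congruence and uniqueness\<close>

lemma orthogonal_gram:
  assumes "Q \<in> orthogonal_group n" "X \<in> carrier_mat n m"
  shows "transpose_mat (Q * X) * (Q * X) = transpose_mat X * X"
proof -
  note Q = orthogonal_groupD[OF assms(1)]
  have "transpose_mat Q * (Q * X) = X"
    using Q assms(2) assoc_mult_mat[of "transpose_mat Q" n n Q n X m] left_mult_one_mat[OF assms(2)]
    by simp
  then show ?thesis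
    using Q(1) assms(2) by (simp add: transpose_mult_dim assoc_mult_mat_dim)
qed

lemma GL_real_left_cancel:
  assumes "X \<in> GL_real n" "A \<in> carrier_mat n m" "B \<in> carrier_mat n m" "X * A = X * B"
  shows "A = B"
proof -
  obtain Y where Y: "Y \<in> GL_real n" "Y * X = 1\<^sub>m n"
    using GL_real_inverse[OF assms(1)] by blast
  have c: "X \<in> carrier_mat n n" "Y \<in> carrier_mat n n"
    using assms(1) Y(1) by (auto simp: GL_real_iff)
  have "Y * X * A = Y * X * B"
    using assoc_mult_mat[OF c(2,1) assms(2)] assoc_mult_mat[OF c(2,1) assms(3)] assms(4) by simp
  then show ?thesis
    using Y(2) left_mult_one_mat[OF assms(2)] left_mult_one_mat[OF assms(3)] by simp
qed

lemma four_block_mat_inject: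
  assumes "four_block_mat A B C D = four_block_mat A' B' C' D'"
    and "A \<in> carrier_mat m1 n1" "B \<in> carrier_mat m1 n2" "C \<in> carrier_mat m2 n1" "D \<in> carrier_mat m2 n2"
    and "A' \<in> carrier_mat m1 n1" "B' \<in> carrier_mat m1 n2" "C' \<in> carrier_mat m2 n1" "D' \<in> carrier_mat m2 n2"
  shows "A = A'" "B = B'" "C = C'" "D = D'"
proof -
  have e: "four_block_mat A B C D $$ (i, j) = four_block_mat A' B' C' D' $$ (i, j)" for i j
    by (simp only: assms(1))
  show "A = A'"
  proof (intro eq_matI)
    fix i j assume "i < dim_row A'" "j < dim_col A'"
    then show "A $$ (i, j) = A' $$ (i, j)" using e[of i j] assms(2-) by simp
  qed (use assms in auto)
  show "B = B'"
  proof (intro eq_matI)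
    fix i j assume "i < dim_row B'" "j < dim_col B'"
    then show "B $$ (i, j) = B' $$ (i, j)" using e[of i "j + n1"] assms(2-) by simp
  qed (use assms in auto)
  show "C = C'"
  proof (intro eq_matI)
    fix i j assume "i < dim_row C'" "j < dim_col C'"
    then show "C $$ (i, j) = C' $$ (i, j)" using e[of "i + m1" j] assms(2-) by simp
  qed (use assms in auto)
  show "D = D'"
  proof (intro eq_matI)
    fix i j assume "i < dim_row D'" "j < dim_col D'"
    then show "D $$ (i, j) = D' $$ (i, j)" using e[of "i + m1" "j + n1"] assms(2-) by simp
  qed (use assms in auto)
qed

text \<open>Some summand of the Leibniz formula for \<open>det L\<close> is nonzero, and its permutation works.\<close>

lemma diagonal_intertwiner_permutation:
  fixes L :: "real mat"
  assumes L: "L \<in> GL_real n" and eq: "L * rect_diag n n d = rect_diag n n d' * L"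
  obtains \<pi> where "\<pi> permutes {..<n}" "\<And>i. i < n \<Longrightarrow> d' i = d (\<pi> i)"
proof -
  have Lc: "L \<in> carrier_mat n n" and "det L \<noteq> 0"
    using L by (auto simp: GL_real_iff)
  then obtain \<pi> where \<pi>: "\<pi> permutes {0..<n}"
      and "signof \<pi> * (\<Prod>i = 0..<n. L $$ (i, \<pi> i)) \<noteq> 0"
    unfolding det_def'[OF Lc] by (metis (mono_tags, lifting) mem_Collect_eq sum.neutral)
  then have nz: "L $$ (i, \<pi> i) \<noteq> 0" if "i < n" for i
    using that by auto
  have diag: "rect_diag n n f = mat_diag n f" for f
    by (intro eq_matI) (auto simp: rect_diag_def mat_diag_def)
  \<comment> \<open>Entrywise, the intertwining relation says that \<open>d j = d' i\<close>
    wherever \<open>L\<close> has a nonzero entry at \<open>(i, j)\<close>.\<close>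
  have entry: "L $$ (i, j) * d j = d' i * L $$ (i, j)" if "i < n" "j < n" for i j
    using arg_cong[OF eq, of "\<lambda>M. M $$ (i, j)"] that
    unfolding diag mat_diag_mult_left[OF Lc] mat_diag_mult_right[OF Lc] by simp
  have "d' i = d (\<pi> i)" if "i < n" for i
  proof -
    have "\<pi> i < n" using permutes_in_image[OF \<pi>, of i] that by simp
    then show ?thesis using entry[OF that, of "\<pi> i"] nz[OF that] by simp
  qed
  with \<pi> that[of \<pi>] show thesis by (simp add: lessThan_atLeast0)
qed

text \<open>Compare the four blocks of the congruence. The upper ones give
  \<open>L1 * W \<alpha> = W \<beta> * L2\<close>, where \<open>W\<close> carries the
  \<open>tanh\<close> values; the lower ones then turn this into a relation for \<open>L2\<close>
  alone. No orthogonality of \<open>L1\<close> or \<open>L2\<close> is assumed.\<close>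

lemma congruent_hyperbolic_mat:
  assumes qp: "q \<le> p" and L1: "L1 \<in> GL_real p" and L2: "L2 \<in> GL_real q"
    and eq: "hyperbolic_mat p q \<alpha>
      = transpose_mat (block_diag L1 L2) * hyperbolic_mat p q \<beta> * block_diag L1 L2"
  shows "L2 * rect_diag q q (\<lambda>i. (tanh (\<alpha> i))\<^sup>2) = rect_diag q q (\<lambda>i. (tanh (\<beta> i))\<^sup>2) * L2"
proof -
  have c: "L1 \<in> carrier_mat p p" "L2 \<in> carrier_mat q q"
    using L1 L2 by (auto simp: GL_real_iff)
  define Cp where "Cp \<gamma> = rect_diag p p (\<lambda>i. if i < q then cosh (\<gamma> i) else (1::real))" for \<gamma>
  define Cq where "Cq \<gamma> = rect_diag q q (\<lambda>i. cosh (\<gamma> i :: real))" for \<gamma>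
  define S where "S \<gamma> = rect_diag p q (\<lambda>i. sinh (\<gamma> i :: real))" for \<gamma>
  define S' where "S' \<gamma> = rect_diag q p (\<lambda>i. sinh (\<gamma> i :: real))" for \<gamma>
  define W where "W \<gamma> = rect_diag p q (\<lambda>i. tanh (\<gamma> i :: real))" for \<gamma>
  define D where "D \<gamma> = rect_diag q q (\<lambda>i. (tanh (\<gamma> i :: real))\<^sup>2)" for \<gamma>
  note defs = Cp_def Cq_def S_def S'_def W_def D_def
  have carr: "Cp \<gamma> \<in> carrier_mat p p" "Cq \<gamma> \<in> carrier_mat q q" "S \<gamma> \<in> carrier_mat p q"
    "S' \<gamma> \<in> carrier_mat q p" "W \<gamma> \<in> carrier_mat p q" "D \<gamma> \<in> carrier_mat q q" for \<gamma>
    by (simp_all add: defs)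
  have tanh: "cosh x * tanh x = sinh x" for x :: real
    by (simp add: tanh_def)
  have CpW: "Cp \<gamma> * W \<gamma> = S \<gamma>" for \<gamma>
    unfolding defs rect_diag_mult by (rule rect_diag_cong) (use tanh in auto)
  have S'W: "S' \<gamma> * W \<gamma> = Cq \<gamma> * D \<gamma>" for \<gamma>
    unfolding defs rect_diag_mult
    by (rule rect_diag_cong) (use qp tanh in \<open>auto simp: power2_eq_square mult.assoc[symmetric]\<close>)
  have inv: "Cp \<gamma> \<in> GL_real p" "Cq \<gamma> \<in> GL_real q" for \<gamma>
  proof -
    show "Cp \<gamma> \<in> GL_real p"
      by (rule GL_real_leftI[of _ _ "rect_diag p p (\<lambda>i. if i < q then 1 / cosh (\<gamma> i) else 1)"])
        (auto simp: carr Cp_def rect_diag_mult rect_diag_one[symmetric] intro!: rect_diag_cong)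
    show "Cq \<gamma> \<in> GL_real q"
      by (rule GL_real_leftI[of _ _ "rect_diag q q (\<lambda>i. 1 / cosh (\<gamma> i))"])
        (auto simp: carr Cq_def rect_diag_mult rect_diag_one[symmetric] intro!: rect_diag_cong)
  qed
  have H: "hyperbolic_mat p q \<gamma> = four_block_mat (Cp \<gamma>) (S \<gamma>) (S' \<gamma>) (Cq \<gamma>)" for \<gamma>
    by (simp add: hyperbolic_mat_diag_blocks[OF qp] diag_blocks_def defs)
  define L1t L2t where "L1t = transpose_mat L1" and "L2t = transpose_mat L2"
  have ct: "L1t \<in> carrier_mat p p" "L2t \<in> carrier_mat q q"
    using c by (auto simp: L1t_def L2t_def)
  have Lt: "L1t \<in> GL_real p" "L2t \<in> GL_real q"
    using L1 L2 by (auto simp: L1t_def L2t_def intro: GL_real_transpose)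
  note dims [simp] = carr[THEN carrier_matD(1)] carr[THEN carrier_matD(2)]
    c[THEN carrier_matD(1)] c[THEN carrier_matD(2)] ct[THEN carrier_matD(1)] ct[THEN carrier_matD(2)]
  have step: "block_diag L1t L2t * hyperbolic_mat p q \<beta>
      = four_block_mat (L1t * Cp \<beta>) (L1t * S \<beta>) (L2t * S' \<beta>) (L2t * Cq \<beta>)"
    unfolding H by (rule block_diag_mult_four_block) (rule ct carr)+
  have cc: "L1t * Cp \<beta> \<in> carrier_mat p p" "L1t * S \<beta> \<in> carrier_mat p q"
     "L2t * S' \<beta> \<in> carrier_mat q p" "L2t * Cq \<beta> \<in> carrier_mat q q"
    by (rule mult_carrier_mat, rule ct, rule carr)+
  have "four_block_mat (Cp \<alpha>) (S \<alpha>) (S' \<alpha>) (Cq \<alpha>) = four_block_mat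
      (L1t * Cp \<beta> * L1) (L1t * S \<beta> * L2) (L2t * S' \<beta> * L1) (L2t * Cq \<beta> * L2)"
    using eq unfolding transpose_block_diag L1t_def[symmetric] L2t_def[symmetric] step
      four_block_mult_block_diag[OF c cc] unfolding H .
  note B = four_block_mat_inject[OF this carr(1,3,4,2) mult_carrier_mat[OF cc(1) c(1)]
      mult_carrier_mat[OF cc(2) c(2)] mult_carrier_mat[OF cc(3) c(1)] mult_carrier_mat[OF cc(4) c(2)]]
  \<comment> \<open>Since \<open>W\<close> is the inverse of \<open>Cp\<close> times
    \<open>S\<close>, both sides equal the upper right block \<open>S \<alpha>\<close>, and the
    invertible factor \<open>L1t * Cp \<beta>\<close> cancels.\<close>
  have "(L1t * Cp \<beta>) * (L1 * W \<alpha>) = Cp \<alpha> * W \<alpha>"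
    by (simp add: B(1) assoc_mult_mat_dim)
  also have "\<dots> = L1t * S \<beta> * L2"
    by (simp add: CpW B(2))
  also have "\<dots> = (L1t * Cp \<beta>) * (W \<beta> * L2)"
    by (simp add: CpW[symmetric] assoc_mult_mat_dim)
  finally have "L1 * W \<alpha> = W \<beta> * L2"
    by (rule GL_real_left_cancel[OF GL_real_mult[OF Lt(1) inv(1)] mult_carrier_mat[OF c(1) carr(5)]
       mult_carrier_mat[OF carr(5) c(2)]])
  \<comment> \<open>Multiplication by \<open>L2t * S' \<beta>\<close> makes the lower left block
    \<open>S' \<alpha>\<close> appear on the left. Then \<open>S' * W = Cq * D\<close> and the lower
    right block expose the common factor \<open>L2t * Cq \<beta>\<close>.\<close>
  then have "L2t * (S' \<beta> * (L1 * W \<alpha>)) = L2t * ((S' \<beta> * W \<beta>) * L2)"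
    by (simp add: assoc_mult_mat_dim)
  then have "S' \<alpha> * W \<alpha> = (L2t * Cq \<beta>) * (D \<beta> * L2)"
    by (simp add: B(3) S'W assoc_mult_mat_dim)
  then have "(L2t * Cq \<beta>) * (L2 * D \<alpha>) = (L2t * Cq \<beta>) * (D \<beta> * L2)"
    by (simp add: S'W B(4) assoc_mult_mat_dim)
  then have "L2 * D \<alpha> = D \<beta> * L2"
    by (rule GL_real_left_cancel[OF GL_real_mult[OF Lt(2) inv(2)] mult_carrier_mat[OF c(2) carr(6)]
       mult_carrier_mat[OF carr(6) c(2)]])
  then show ?thesis by (simp add: D_def)
qed

text \<open>Let \<open>K\<close> invert the block diagonal factor of the first decomposition. The
  Gram matrix of \<open>G * K\<close> is the hyperbolic matrix of \<open>2 \<theta>\<close> by the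
  first decomposition and a block diagonal congruence of that of \<open>2 \<theta>'\<close> by the
  second, so the squares of \<open>tanh\<close> agree up to a permutation.\<close>

lemma hyperbolic_decomposition_unique:
  assumes qp: "q \<le> p"
    and dec: "hyperbolic_decomposition p q G Q \<theta> Gp Gq" "hyperbolic_decomposition p q G Q' \<theta>' Gp' Gq'"
  shows "eq_up_to_order_and_signs q \<theta> \<theta>'"
proof -
  let ?H = "hyperbolic_mat p q"
  have mems: "Q \<in> orthogonal_group (p + q)" "Gp \<in> GL_real p" "Gq \<in> GL_real q"
    "Q' \<in> orthogonal_group (p + q)" "Gp' \<in> GL_real p" "Gq' \<in> GL_real q"
    using dec by (auto simp: hyperbolic_decomposition_def)
  obtain Kp where Kp: "Kp \<in> GL_real p" "Gp * Kp = 1\<^sub>m p"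
    using GL_real_inverse[OF mems(2)] by blast
  obtain Kq where Kq: "Kq \<in> GL_real q" "Gq * Kq = 1\<^sub>m q"
    using GL_real_inverse[OF mems(3)] by blast
  have c: "Q \<in> carrier_mat (p + q) (p + q)" "Gp \<in> carrier_mat p p" "Gq \<in> carrier_mat q q"
    "Q' \<in> carrier_mat (p + q) (p + q)" "Gp' \<in> carrier_mat p p" "Gq' \<in> carrier_mat q q"
    "Kp \<in> carrier_mat p p" "Kq \<in> carrier_mat q q"
    using mems Kp(1) Kq(1) by (auto simp: GL_real_iff orthogonal_groupD(1))
  have Hc: "?H \<gamma> \<in> carrier_mat (p + q) (p + q)" for \<gamma>
    by (rule hyperbolic_mat_carrier[OF qp])
  note [simp] = c[THEN carrier_matD(1)] c[THEN carrier_matD(2)] Hc[THEN carrier_matD(1)] Hc[THEN carrier_matD(2)]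
  have G: "G = Q * ?H \<theta> * block_diag Gp Gq" "G = Q' * ?H \<theta>' * block_diag Gp' Gq'"
    using dec by (auto simp: hyperbolic_decomposition_def block_diag_def)
  define K where "K = block_diag Kp Kq"
  define L where "L = block_diag (Gp' * Kp) (Gq' * Kq)"
  have Lc: "L \<in> carrier_mat (p + q) (p + q)"
    using mult_carrier_mat[OF c(5,7)] mult_carrier_mat[OF c(6,8)] by (simp add: L_def)
  have "block_diag Gp Gq * K = 1\<^sub>m (p + q)"
    by (simp add: K_def block_diag_mult Kp Kq)
  then have "G * K = Q * ?H \<theta>"
    using right_mult_one_mat[OF Hc] unfolding G(1) by (simp add: K_def assoc_mult_mat_dim)
  then have 1: "transpose_mat (G * K) * (G * K) = ?H (\<lambda>i. \<theta> i + \<theta> i)"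
    using orthogonal_gram[OF mems(1) Hc] by (simp add: transpose_hyperbolic_mat[OF qp] hyperbolic_mat_mult[OF qp])
  have "block_diag Gp' Gq' * K = L"
    by (simp add: K_def L_def block_diag_mult)
  then have "G * K = Q' * (?H \<theta>' * L)"
    unfolding G(2) by (simp add: K_def assoc_mult_mat_dim)
  then have "transpose_mat (G * K) * (G * K) = transpose_mat L * (?H \<theta>' * ?H \<theta>') * L"
    using orthogonal_gram[OF mems(4) mult_carrier_mat[OF Hc Lc]] Lc
    by (simp add: transpose_mult_dim assoc_mult_mat_dim transpose_hyperbolic_mat[OF qp])
  then have "?H (\<lambda>i. \<theta> i + \<theta> i) = transpose_mat L * ?H (\<lambda>i. \<theta>' i + \<theta>' i) * L"
    unfolding 1 hyperbolic_mat_mult[OF qp] .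
  then have "Gq' * Kq * rect_diag q q (\<lambda>i. (tanh (\<theta> i + \<theta> i))\<^sup>2)
      = rect_diag q q (\<lambda>i. (tanh (\<theta>' i + \<theta>' i))\<^sup>2) * (Gq' * Kq)"
    unfolding L_def
    by (rule congruent_hyperbolic_mat[OF qp GL_real_mult[OF mems(5) Kp(1)] GL_real_mult[OF mems(6) Kq(1)]])
  from diagonal_intertwiner_permutation[OF GL_real_mult[OF mems(6) Kq(1)] this]
  obtain \<pi> where \<pi>: "\<pi> permutes {..<q}"
      "\<And>i. i < q \<Longrightarrow> (tanh (\<theta>' i + \<theta>' i))\<^sup>2 = (tanh (\<theta> (\<pi> i) + \<theta> (\<pi> i)))\<^sup>2"
    by blast
  have "\<theta>' i = \<theta> (\<pi> i) \<or> \<theta>' i = - \<theta> (\<pi> i)" if "i < q" for i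
  proof -
    \<comment> \<open>Equal squares leave a sign, which moves inside because \<open>tanh\<close> is
      odd; injectivity of \<open>tanh\<close> then removes it.\<close>
    have "tanh (\<theta>' i + \<theta>' i) = tanh (\<theta> (\<pi> i) + \<theta> (\<pi> i))
        \<or> tanh (\<theta>' i + \<theta>' i) = tanh (- (\<theta> (\<pi> i) + \<theta> (\<pi> i)))"
      using \<pi>(2)[OF that] by (simp add: power2_eq_iff)
    then show ?thesis
      unfolding tanh_real_eq_iff by auto
  qed
  with \<pi>(1) show ?thesis
    by (auto simp: eq_up_to_order_and_signs_def)
qed

section \<open>Existence\<close>

text \<open>The entry is the squared norm of column \<open>i\<close>, which is nonzero because its
  product with row \<open>i\<close> of the inverse is \<open>1\<close>.\<close>

lemma GL_real_gram_diag_pos: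
  assumes Z: "Z \<in> GL_real n" and i: "i < n"
  shows "0 < (transpose_mat Z * Z) $$ (i, i)"
proof -
  have Zc: "Z \<in> carrier_mat n n" using Z by (auto simp: GL_real_iff)
  obtain W where W: "W \<in> GL_real n" "W * Z = 1\<^sub>m n"
    using GL_real_inverse[OF Z] by blast
  have Wc: "W \<in> carrier_mat n n" using W(1) by (auto simp: GL_real_iff)
  have "row W i \<bullet> col Z i = 1"
    using arg_cong[OF W(2), of "\<lambda>M. M $$ (i, i)"] Zc Wc i by simp
  moreover have "row W i \<in> carrier_vec n"
    using Wc i by simp
  ultimately have "col Z i \<noteq> 0\<^sub>v n"
    by auto
  then have "0 < col Z i \<bullet> col Z i"
    using Zc i by (intro scalar_prod_self_pos[of _ n]) auto
  then show ?thesis using Zc i by simp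
qed

text \<open>The left inverse \<open>B\<close> expresses full column rank. In the singular value
  decomposition of \<open>A\<close>, the \<open>n\<close>-by-\<open>p\<close> diagonal factor splits
  into the inclusion of the first \<open>p\<close> coordinates and a square diagonal matrix. So
  \<open>J\<close> consists of the first \<open>p\<close> columns of \<open>U\<close>, and
  \<open>X\<close> is the rest.\<close>

lemma orthonormal_factorization:
  fixes A :: "real mat"
  assumes A: "A \<in> carrier_mat n p" and B: "B \<in> carrier_mat p n" "B * A = 1\<^sub>m p" and pn: "p \<le> n"
  obtains J X where "J \<in> carrier_mat n p" "transpose_mat J * J = 1\<^sub>m p" "X \<in> GL_real p" "A = J * X"
proof -
  obtain U V s where U: "U \<in> orthogonal_group n" and V: "V \<in> orthogonal_group p"
      and svd: "transpose_mat U * A * V = rect_diag n p s"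
    using singular_value_decomposition[OF A pn] by blast
  note Uc = orthogonal_groupD[OF U] and Vc = orthogonal_groupD[OF V]
  define J where "J = U * rect_diag n p (\<lambda>_. 1)"
  define X where "X = rect_diag p p s * transpose_mat V"
  have Jc: "J \<in> carrier_mat n p"
    unfolding J_def by (rule mult_carrier_mat[OF Uc(1) rect_diag_carrier])
  have Xc: "X \<in> carrier_mat p p"
    unfolding X_def using Vc(1) by (intro mult_carrier_mat[OF rect_diag_carrier]) simp
  have one: "rect_diag p p (\<lambda>i. if i < n then 1 * 1 else 0) = 1\<^sub>m p"
    unfolding rect_diag_one[symmetric] using pn by (intro rect_diag_cong) auto
  have JJ: "transpose_mat J * J = 1\<^sub>m p"
    unfolding J_def orthogonal_gram[OF U rect_diag_carrier] transpose_rect_diag rect_diag_mult by (rule one)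
  have "rect_diag n p (\<lambda>_. 1) * rect_diag p p s = rect_diag n p s"
    unfolding rect_diag_mult by (rule rect_diag_cong) simp
  then have "J * X = U * (rect_diag n p s * transpose_mat V)"
    unfolding J_def X_def using Uc(1) Vc(1) assoc_mult_mat[of "rect_diag n p (\<lambda>_. 1)" n p "rect_diag p p s" p "transpose_mat V" p]
    by (simp add: assoc_mult_mat_dim)
  also have "\<dots> = (U * transpose_mat U) * (A * (V * transpose_mat V))"
    unfolding svd[symmetric] using Uc(1) Vc(1) A by (simp add: assoc_mult_mat_dim)
  also have "\<dots> = A"
    using Uc(3) Vc(3) left_mult_one_mat[OF A] right_mult_one_mat[OF A] by simp
  finally have AJX: "A = J * X" by simp
  \<comment> \<open>Thus \<open>B * J\<close> is a left inverse of the square matrix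
    \<open>X\<close>; no \<open>s i\<close> has to be examined.\<close>
  have "B * J * X = 1\<^sub>m p"
    using B(2) unfolding AJX using assoc_mult_mat[OF B(1) Jc Xc] by simp
  then have "X \<in> GL_real p"
    by (rule GL_real_leftI[OF Xc mult_carrier_mat[OF B(1) Jc]])
  then show thesis
    using that[OF Jc JJ] AJX by blast
qed

lemma tanh_artanh_real:
  fixes x :: real
  assumes "\<bar>x\<bar> < 1"
  shows "tanh (artanh x) = x"
proof -
  have "1 + x \<noteq> 0" using assms by auto
  have "exp (- 2 * artanh x) = (1 - x) / (1 + x)"
    using assms by (simp add: artanh_def exp_minus)
  moreover have "(1 - (1 - x) / (1 + x)) / (1 + (1 - x) / (1 + x)) = x"
    using \<open>1 + x \<noteq> 0\<close> by (simp add: divide_simps)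
  ultimately show ?thesis
    by (simp only: tanh_real_altdef)
qed

text \<open>Juxtaposition is a four-block matrix with an empty lower row, so the multiplication
  rules for four blocks apply.\<close>

definition hcat :: "real mat \<Rightarrow> real mat \<Rightarrow> real mat" where
  "hcat A B = four_block_mat A B (0\<^sub>m 0 (dim_col A)) (0\<^sub>m 0 (dim_col B))"

lemma hcat_carrier:
  assumes "A \<in> carrier_mat n p" "B \<in> carrier_mat n q"
  shows "hcat A B \<in> carrier_mat n (p + q)"
  using four_block_carrier_mat[OF assms(1), of "0\<^sub>m 0 q" 0 q B "0\<^sub>m 0 p"] assms by (simp add: hcat_def)

lemma hcat_mult_block_diag:
  assumes "A \<in> carrier_mat n p" "B \<in> carrier_mat n q" "X \<in> carrier_mat p p" "Y \<in> carrier_mat q q"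
  shows "hcat A B * block_diag X Y = hcat (A * X) (B * Y)"
  using four_block_mult_block_diag[OF assms(3,4,1,2), of "0\<^sub>m 0 p" 0 "0\<^sub>m 0 q"] assms
  by (simp add: hcat_def)

lemma hcat_gram:
  assumes "A \<in> carrier_mat n p" "B \<in> carrier_mat n q"
  shows "transpose_mat (hcat A B) * hcat A B = four_block_mat
    (transpose_mat A * A) (transpose_mat A * B) (transpose_mat B * A) (transpose_mat B * B)"
proof -
  have t: "transpose_mat A \<in> carrier_mat p n" "transpose_mat B \<in> carrier_mat q n"
    using assms by auto
  have "transpose_mat (hcat A B) * hcat A B =
      four_block_mat (transpose_mat A) (0\<^sub>m p 0) (transpose_mat B) (0\<^sub>m q 0)
      * four_block_mat A B (0\<^sub>m 0 p) (0\<^sub>m 0 q)"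
    using assms transpose_four_block_mat[OF assms, of "0\<^sub>m 0 p" 0 "0\<^sub>m 0 q"] by (simp add: hcat_def)
  also have "\<dots> = four_block_mat
      (transpose_mat A * A + 0\<^sub>m p 0 * 0\<^sub>m 0 p) (transpose_mat A * B + 0\<^sub>m p 0 * 0\<^sub>m 0 q)
      (transpose_mat B * A + 0\<^sub>m q 0 * 0\<^sub>m 0 p) (transpose_mat B * B + 0\<^sub>m q 0 * 0\<^sub>m 0 q)"
    by (rule mult_four_block_mat[OF t(1) _ t(2) _ assms]) auto
  also have "\<dots> = four_block_mat
    (transpose_mat A * A) (transpose_mat A * B) (transpose_mat B * A) (transpose_mat B * B)"
    using right_add_zero_mat[OF mult_carrier_mat[OF t(1) assms(1)]]
      right_add_zero_mat[OF mult_carrier_mat[OF t(1) assms(2)]]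
      right_add_zero_mat[OF mult_carrier_mat[OF t(2) assms(1)]]
      right_add_zero_mat[OF mult_carrier_mat[OF t(2) assms(2)]] by simp
  finally show ?thesis .
qed

text \<open>Each of the two column blocks of \<open>G\<close> has a left inverse, namely the
  matching row block of the inverse of \<open>G\<close>, so each can be orthonormalised on its
  own.\<close>

lemma GL_real_columns_factorization:
  fixes G :: "real mat"
  assumes G: "G \<in> GL_real (p + q)"
  obtains A B X Y where "A \<in> carrier_mat (p + q) p" "B \<in> carrier_mat (p + q) q"
    "transpose_mat A * A = 1\<^sub>m p" "transpose_mat B * B = 1\<^sub>m q" "X \<in> GL_real p" "Y \<in> GL_real q"
    "G = hcat A B * block_diag X Y"
proof -
  define n where "n = p + q"
  have Gc: "G \<in> carrier_mat n n" using G by (auto simp: GL_real_iff n_def)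
  obtain W where W: "W \<in> GL_real n" "W * G = 1\<^sub>m n"
    using GL_real_inverse[OF G] by (auto simp: n_def)
  have Wc: "W \<in> carrier_mat n n" using W(1) by (auto simp: GL_real_iff)
  have WG: "(\<Sum>k\<in>{0..<n}. W $$ (i, k) * G $$ (k, j)) = (if i = j then 1 else 0)" if "i < n" "j < n" for i j
    using arg_cong[OF W(2), of "\<lambda>M. M $$ (i, j)"] that Gc Wc by (simp add: scalar_prod_def)
  define A0 where "A0 = mat n p (\<lambda>(i,j). G $$ (i, j))"
  define A1 where "A1 = mat p n (\<lambda>(i,j). W $$ (i, j))"
  define B0 where "B0 = mat n q (\<lambda>(i,j). G $$ (i, j + p))"
  define B1 where "B1 = mat q n (\<lambda>(i,j). W $$ (i + p, j))"
  have c: "A0 \<in> carrier_mat n p" "A1 \<in> carrier_mat p n" "B0 \<in> carrier_mat n q" "B1 \<in> carrier_mat q n"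
    by (simp_all add: A0_def A1_def B0_def B1_def)
  have "A1 * A0 = 1\<^sub>m p"
  proof (intro eq_matI)
    fix i j assume "i < dim_row (1\<^sub>m p :: real mat)" "j < dim_col (1\<^sub>m p :: real mat)"
    then show "(A1 * A0) $$ (i, j) = 1\<^sub>m p $$ (i, j)"
      using WG[of i j] by (simp add: A0_def A1_def scalar_prod_def n_def)
  qed (simp_all add: A0_def A1_def)
  then obtain A X where A: "A \<in> carrier_mat n p" "transpose_mat A * A = 1\<^sub>m p" "X \<in> GL_real p" "A0 = A * X"
    using orthonormal_factorization[OF c(1,2)] by (auto simp: n_def)
  have "B1 * B0 = 1\<^sub>m q"
  proof (intro eq_matI)
    fix i j assume "i < dim_row (1\<^sub>m q :: real mat)" "j < dim_col (1\<^sub>m q :: real mat)"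
    then show "(B1 * B0) $$ (i, j) = 1\<^sub>m q $$ (i, j)"
      using WG[of "i + p" "j + p"] by (simp add: B0_def B1_def scalar_prod_def n_def)
  qed (simp_all add: B0_def B1_def)
  then obtain B Y where B: "B \<in> carrier_mat n q" "transpose_mat B * B = 1\<^sub>m q" "Y \<in> GL_real q" "B0 = B * Y"
    using orthonormal_factorization[OF c(3,4)] by (auto simp: n_def)
  have XY: "X \<in> carrier_mat p p" "Y \<in> carrier_mat q q"
    using A(3) B(3) by (auto simp: GL_real_iff)
  have "G = hcat A0 B0"
  proof (intro eq_matI)
    fix i j assume "i < dim_row (hcat A0 B0)" "j < dim_col (hcat A0 B0)"
    then show "G $$ (i, j) = hcat A0 B0 $$ (i, j)"
      by (auto simp: hcat_def A0_def B0_def n_def)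
  qed (use Gc in \<open>auto simp: hcat_def A0_def B0_def n_def\<close>)
  then have "G = hcat A B * block_diag X Y"
    by (simp add: hcat_mult_block_diag[OF A(1) B(1) XY] A(4) B(4))
  then show thesis
    using that[of A B X Y] A B by (simp add: n_def)
qed

section \<open>Construction of the decomposition\<close>

text \<open>Block elimination: the unitriangular \<open>R\<close> makes the Gram matrix diagonal,
  with \<open>1 - s i * s i\<close> at position \<open>i + p\<close>. As \<open>M * R\<close> is
  still invertible, this entry is positive.\<close>

lemma gram_off_diagonal_bound:
  assumes qp: "q \<le> p" and M: "M \<in> GL_real (p + q)" and i: "i < q"
    and gram: "transpose_mat M * M = diag_blocks p q (\<lambda>_. 1) s s (\<lambda>_. 1)"
  shows "\<bar>s i\<bar> < 1"
proof -
  define R where "R = diag_blocks p q (\<lambda>_. 1) (\<lambda>i. - s i) (\<lambda>_. 0) (\<lambda>_. 1)"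
  have Rc: "R \<in> carrier_mat (p + q) (p + q)" by (simp add: R_def)
  have Mc: "M \<in> carrier_mat (p + q) (p + q)" using M by (simp add: GL_real_iff)
  have "diag_blocks p q (\<lambda>_. 1) s (\<lambda>_. 0) (\<lambda>_. 1) * R = 1\<^sub>m (p + q)"
    unfolding R_def diag_blocks_mult[OF qp] diag_blocks_one[symmetric] by (rule diag_blocks_cong) auto
  then have "R \<in> GL_real (p + q)"
    by (rule GL_real_leftI[OF Rc diag_blocks_carrier])
  then have "M * R \<in> GL_real (p + q)"
    by (rule GL_real_mult[OF M])
  then have "0 < (transpose_mat (M * R) * (M * R)) $$ (i + p, i + p)"
    by (rule GL_real_gram_diag_pos) (use i in simp)
  also have "transpose_mat (M * R) * (M * R) = transpose_mat R * ((transpose_mat M * M) * R)"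
    using Mc Rc by (simp add: transpose_mult_dim assoc_mult_mat_dim)
  also have "\<dots> = diag_blocks p q (\<lambda>_. 1) (\<lambda>_. 0) (\<lambda>_. 0) (\<lambda>i. 1 - s i * s i)"
    unfolding gram R_def transpose_diag_blocks diag_blocks_mult[OF qp] by (rule diag_blocks_cong) auto
  also have "\<dots> $$ (i + p, i + p) = 1 - s i * s i"
    using i by (simp add: diag_blocks_def) (simp add: rect_diag_def)
  finally show ?thesis
    by (simp add: abs_square_less_1[symmetric] power2_eq_square)
qed

lemma hyperbolic_decomposition_exists:
  assumes qp: "q \<le> p" and G: "G \<in> GL_real (p + q)"
  shows "\<exists>\<theta> Q Gp Gq. hyperbolic_decomposition p q G Q \<theta> Gp Gq"
proof -
  define n where "n = p + q"
  obtain A0 B0 X0 Y0 where AB: "A0 \<in> carrier_mat n p" "B0 \<in> carrier_mat n q"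
    "transpose_mat A0 * A0 = 1\<^sub>m p" "transpose_mat B0 * B0 = 1\<^sub>m q" "X0 \<in> GL_real p" "Y0 \<in> GL_real q"
    "G = hcat A0 B0 * block_diag X0 Y0"
    using GL_real_columns_factorization[OF G] unfolding n_def by blast
  have "transpose_mat A0 * B0 \<in> carrier_mat p q"
    using AB(1,2) by (intro mult_carrier_mat[of _ p n]) auto
  \<comment> \<open>The \<open>s i\<close> are, up to sign, the cosines of the principal angles
    between the two column spans. Rotating \<open>A0\<close> by \<open>U\<close> and
    \<open>B0\<close> by \<open>V\<close> yields bases that realise them, and the inverse rotations
    go into \<open>X\<close> and \<open>Y\<close>.\<close>
  from singular_value_decomposition[OF this qp]
  obtain U V s where U: "U \<in> orthogonal_group p" and V: "V \<in> orthogonal_group q"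
    and svd: "transpose_mat U * (transpose_mat A0 * B0) * V = rect_diag p q s"
    by blast
  note Uc = orthogonal_groupD[OF U] and Vc = orthogonal_groupD[OF V]
  have XYc: "X0 \<in> carrier_mat p p" "Y0 \<in> carrier_mat q q"
    using AB(5,6) by (auto simp: GL_real_iff)
  define A where "A = A0 * U"
  define B where "B = B0 * V"
  define X where "X = transpose_mat U * X0"
  define Y where "Y = transpose_mat V * Y0"
  define M where "M = hcat A B"
  have X: "X \<in> GL_real p" and Y: "Y \<in> GL_real q"
    using AB(5,6) orthogonal_group_GL_real[OF U] orthogonal_group_GL_real[OF V]
    by (auto simp: X_def Y_def intro!: GL_real_mult GL_real_transpose)
  have Xc: "X \<in> carrier_mat p p" and Yc: "Y \<in> carrier_mat q q"
    using X Y by (auto simp: GL_real_iff)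
  have Ac: "A \<in> carrier_mat n p" and Bc: "B \<in> carrier_mat n q"
    unfolding A_def B_def by (rule mult_carrier_mat[OF AB(1) Uc(1)], rule mult_carrier_mat[OF AB(2) Vc(1)])
  have Mc: "M \<in> carrier_mat n n"
    using hcat_carrier[OF Ac Bc] by (simp add: M_def n_def)
  have "A * X = A0 * (U * transpose_mat U) * X0" "B * Y = B0 * (V * transpose_mat V) * Y0"
    using AB(1,2) Uc(1) Vc(1) XYc by (simp_all add: A_def B_def X_def Y_def assoc_mult_mat_dim)
  then have "A * X = A0 * X0" "B * Y = B0 * Y0"
    using Uc(3) Vc(3) right_mult_one_mat[OF AB(1)] right_mult_one_mat[OF AB(2)] by simp_all
  then have GM: "G = M * block_diag X Y"
    unfolding M_def hcat_mult_block_diag[OF Ac Bc Xc Yc] AB(7) hcat_mult_block_diag[OF AB(1,2) XYc] by simp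
  have M: "M \<in> GL_real n"
    using GL_real_mult_cancel(1)[of M "block_diag X Y" n] G GM Mc block_diag_carrier[OF Xc Yc]
    by (simp add: n_def)
  have "transpose_mat A * A = transpose_mat U * ((transpose_mat A0 * A0) * U)"
    "transpose_mat B * B = transpose_mat V * ((transpose_mat B0 * B0) * V)"
    "transpose_mat A * B = rect_diag p q s"
    unfolding svd[symmetric] using AB(1,2) Uc(1) Vc(1)
    by (simp_all add: A_def B_def transpose_mult_dim assoc_mult_mat_dim)
  then have blocks: "transpose_mat A * A = 1\<^sub>m p" "transpose_mat B * B = 1\<^sub>m q"
    "transpose_mat A * B = rect_diag p q s"
    using Uc Vc AB(3,4) left_mult_one_mat[OF Uc(1)] left_mult_one_mat[OF Vc(1)] by simp_all
  have "transpose_mat B * A = transpose_mat (transpose_mat A * B)"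
    using Ac Bc by (simp add: transpose_mult_dim)
  then have "transpose_mat B * A = rect_diag q p s"
    unfolding blocks by simp
  then have gram: "transpose_mat M * M = diag_blocks p q (\<lambda>_. 1) s s (\<lambda>_. 1)"
    unfolding M_def hcat_gram[OF Ac Bc] blocks by (simp add: diag_blocks_def rect_diag_one)
  define \<theta> where "\<theta> i = artanh (s i) / 2" for i
  have tanh: "tanh (\<theta> i + \<theta> i) = s i" if "i < q" for i
    using tanh_artanh_real[OF gram_off_diagonal_bound[OF qp M[unfolded n_def] that gram]] by (simp add: \<theta>_def)
  \<comment> \<open>Scaling both sides by \<open>r\<close> turns the diagonal entry \<open>1\<close>
    into \<open>cosh (2 \<theta> i)\<close> and the off-diagonal
    \<open>s i = tanh (2 \<theta> i)\<close> into \<open>sinh (2 \<theta> i)\<close>.\<close>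
  define r where "r i = sqrt (cosh (\<theta> i + \<theta> i))" for i
  have r: "r i * r i = cosh (\<theta> i + \<theta> i)" "r i > 0" for i
    by (simp_all add: r_def)
  have sinh: "r i * s i * r i = sinh (\<theta> i + \<theta> i)" if "i < q" for i
    using r(1)[of i] tanh[OF that] by (simp add: tanh_def field_simps)
  define E where "E = diag_blocks p q (\<lambda>i. if i < q then r i else 1) (\<lambda>_. 0) (\<lambda>_. 0) r"
  define F1 where "F1 = rect_diag p p (\<lambda>i. if i < q then 1 / r i else 1)"
  define F2 where "F2 = rect_diag q q (\<lambda>i. 1 / r i)"
  let ?H = "hyperbolic_mat p q"
  have EKE: "E * diag_blocks p q (\<lambda>_. 1) s s (\<lambda>_. 1) * E = ?H (\<lambda>i. \<theta> i + \<theta> i)"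
    unfolding E_def hyperbolic_mat_diag_blocks[OF qp] diag_blocks_mult[OF qp]
    by (rule diag_blocks_cong) (use qp r sinh in \<open>auto simp: mult.commute mult.left_commute\<close>)
  have EF: "E * block_diag F1 F2 = 1\<^sub>m n"
    unfolding E_def F1_def F2_def block_diag_rect_diag diag_blocks_mult[OF qp] n_def diag_blocks_one[symmetric]
    by (rule diag_blocks_cong) (use r(2) in \<open>auto simp: less_imp_neq[symmetric]\<close>)
  have Hc: "?H \<gamma> \<in> carrier_mat n n" for \<gamma>
    unfolding n_def by (rule hyperbolic_mat_carrier[OF qp])
  have Ec: "E \<in> carrier_mat n n" by (simp add: E_def n_def)
  have Fc: "F1 \<in> carrier_mat p p" "F2 \<in> carrier_mat q q"
    by (simp_all add: F1_def F2_def)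
  have FGL: "F1 \<in> GL_real p" "F2 \<in> GL_real q"
  proof -
    have "block_diag F1 F2 \<in> GL_real (p + q)"
      using GL_real_leftI[OF block_diag_carrier[OF Fc], of E] EF Ec by (simp add: n_def)
    then show "F1 \<in> GL_real p" "F2 \<in> GL_real q"
      using block_diag_GL_real_iff[OF Fc] by auto
  qed
  have HH: "?H (\<lambda>i. - \<theta> i) * ?H (\<lambda>i. \<theta> i + \<theta> i) = ?H \<theta>" "?H \<theta> * ?H (\<lambda>i. - \<theta> i) = 1\<^sub>m n"
      "?H (\<lambda>i. - \<theta> i) * ?H \<theta> = 1\<^sub>m n"
    by (simp_all add: hyperbolic_mat_mult[OF qp] hyperbolic_mat_zero[OF qp] n_def)
  \<comment> \<open>Solving \<open>Q * H \<theta> = M * E\<close> for \<open>Q\<close>. Since the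
    Gram matrix of \<open>M * E\<close> is the hyperbolic matrix of \<open>2 \<theta>\<close>,
    multiplying it by that of \<open>- \<theta>\<close> on both sides leaves the identity.\<close>
  define Q where "Q = M * (E * ?H (\<lambda>i. - \<theta> i))"
  have EHc: "E * ?H (\<lambda>i. - \<theta> i) \<in> carrier_mat n n"
    by (rule mult_carrier_mat[OF Ec Hc])
  have Qc: "Q \<in> carrier_mat n n"
    unfolding Q_def by (rule mult_carrier_mat[OF Mc EHc])
  have Et: "transpose_mat E = E" by (simp add: E_def)
  note [simp] = Hc[THEN carrier_matD(1)] Hc[THEN carrier_matD(2)]
  have "transpose_mat Q * Q = ?H (\<lambda>i. - \<theta> i) * (E * ((transpose_mat M * M) * E)) * ?H (\<lambda>i. - \<theta> i)"
    using Mc Ec by (simp add: Q_def transpose_mult_dim assoc_mult_mat_dim Et transpose_hyperbolic_mat[OF qp])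
  also have "E * ((transpose_mat M * M) * E) = ?H (\<lambda>i. \<theta> i + \<theta> i)"
    unfolding gram EKE[symmetric] by (simp add: E_def assoc_mult_mat_dim)
  finally have "transpose_mat Q * Q = 1\<^sub>m n"
    by (simp only: HH)
  then have Q: "Q \<in> orthogonal_group (p + q)"
    using Qc by (simp add: orthogonal_group_def n_def)
  have "Q * ?H \<theta> = M * (E * (?H (\<lambda>i. - \<theta> i) * ?H \<theta>))"
    using Mc Ec by (simp add: Q_def assoc_mult_mat_dim)
  also have "\<dots> = M * E"
    using right_mult_one_mat[OF Ec] by (simp add: HH)
  finally have QH: "Q * ?H \<theta> = M * E" .
  have "block_diag (F1 * X) (F2 * Y) = block_diag F1 F2 * block_diag X Y"
    using Fc Xc Yc by (simp add: block_diag_mult)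
  \<comment> \<open>The scaling \<open>E\<close> is undone inside the block diagonal factor by
    \<open>F1\<close> and \<open>F2\<close>.\<close>
  then have "Q * ?H \<theta> * block_diag (F1 * X) (F2 * Y) = M * ((E * block_diag F1 F2) * block_diag X Y)"
    unfolding QH using Mc Ec Fc Xc Yc by (simp add: assoc_mult_mat_dim n_def)
  also have "\<dots> = G"
    using left_mult_one_mat[OF block_diag_carrier[OF Xc Yc]] EF by (simp add: GM n_def)
  finally have "G = Q * ?H \<theta> * block_diag (F1 * X) (F2 * Y)" by simp
  then have "hyperbolic_decomposition p q G Q \<theta> (F1 * X) (F2 * Y)"
    using Q GL_real_mult[OF FGL(1) X] GL_real_mult[OF FGL(2) Y] Fc Xc Yc
    by (simp add: hyperbolic_decomposition_def block_diag_def)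
  then show ?thesis by blast
qed

theorem theorem5p3:
  fixes n p q :: nat and G :: "real mat"
  assumes "n = p + q" and "q \<le> p"
    and "G \<in> carrier_mat n n" and "invertible_mat G"
  shows "\<exists>\<theta> :: nat \<Rightarrow> real.
           (\<exists>Q Gp Gq. hyperbolic_decomposition p q G Q \<theta> Gp Gq) \<and>
           (\<forall>\<theta>' Q' Gp' Gq'. hyperbolic_decomposition p q G Q' \<theta>' Gp' Gq' \<longrightarrow>
              eq_up_to_order_and_signs q \<theta> \<theta>')"
proof -
  have "G \<in> GL_real (p + q)"
    using assms by (simp add: GL_real_def)
  then obtain \<theta> Q Gp Gq where "hyperbolic_decomposition p q G Q \<theta> Gp Gq"
    using hyperbolic_decomposition_exists[OF assms(2)] by blast
  then show ?thesis
    using hyperbolic_decomposition_unique[OF assms(2)] by blast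
qed

end
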